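(* Let $1\le p<+\infty$, let $\sigma_R$ be the ramp function, $\sigma_R(x)=0$ for $x<-\frac12$, $\sigma_R(x)=x+\frac12$ for $-\frac12\le x\le\frac12$, $\sigma_R(x)=1$ for $x>\frac12$. Let $N,M$ be positive integers and let $\widetilde f:[0,N]\times[0,M]\to\mathbb{R}$ be a digital image function, i.e. $\widetilde f=\sum_{i=1}^N\sum_{j=1}^M F_{i,j}\chi_{i,j}$ with $F_{i,j}\in\{0,1,\dots,255\}$. Then there is a constant $C>0$, independent of $n$, such that for all sufficiently large $n\in\mathbb{N}$ $$\|F_n^{\sigma_R}(\widetilde f,\cdot)-\widetilde f(\cdot)\|_p\ \le\ 255\,(2^{p-1}MN)^{1/p}\,C\left(\frac{\ln n}{n}\right)^{1/p}.$$
   Context: Let $I=[0,N]\times[0,M]$. For $1\le i\le N$, $1\le j\le M$, $\chi_{i,j}$ is the characteristic function of the unit pixel which is the product of $[i-1,i)$ (closed on the right if $i=N$) and $[j-1,j)$ (closed on the right if $j=M$); these pixels partition $I$. Set $\phi_{\sigma_R}(x)=\frac12[\sigma_R(x+1)-\sigma_R(x-1)]$, $\Psi_{\sigma_R}(\mathtt{x})=\phi_{\sigma_R}(x_1)\phi_{\sigma_R}(x_2)$ for $\mathtt{x}=(x_1,x_2)\in\mathbb{R}^2$, and $\mathcal{A}_n=\{\mathtt{k}\in\mathbb{Z}^2:0\le k_1\le nN,\ 0\le k_2\le nM\}$. The neural network operators activated by $\sigma_R$ are $$F_n^{\sigma_R}(f,\mathtt{x})=\frac{\sum_{\mathtt{k}\in\mathcal{A}_n}f(\mathtt{k}/n)\,\Psi_{\sigma_R}(n\mathtt{x}-\mathtt{k})}{\sum_{\mathtt{k}\in\mathcal{A}_n}\Psi_{\sigma_R}(n\mathtt{x}-\mathtt{k})},\qquad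 \mathtt{x}\in I,\ \mathtt{k}/n=(k_1/n,k_2/n).$$ $\|\cdot\|_p$ is the $L^p(I)$-norm with respect to Lebesgue measure. *)

theory Defs
  imports "HOL-Analysis.Analysis"
begin

definition ramp :: "real \<Rightarrow> real" where
  "ramp x = (if x < - 1/2 then 0 else if x \<le> 1/2 then x + 1/2 else 1)"

definition phi :: "(real \<Rightarrow> real) \<Rightarrow> real \<Rightarrow> real" where
  "phi \<sigma> x = 1/2 * (\<sigma> (x + 1) - \<sigma> (x - 1))"

definition Psi :: "(real \<Rightarrow> real) \<Rightarrow> real \<times> real \<Rightarrow> real" where
  "Psi \<sigma> x = phi \<sigma> (fst x) * phi \<sigma> (snd x)"

definition rect :: "nat \<Rightarrow> nat \<Rightarrow> (real \<times> real) set" where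
  "rect N M = {0..real N} \<times> {0..real M}"

definition grid :: "nat \<Rightarrow> nat \<Rightarrow> nat \<Rightarrow> (int \<times> int) set" where
  "grid N M n = {0..int n * int N} \<times> {0..int n * int M}"

definition node :: "nat \<Rightarrow> int \<times> int \<Rightarrow> real \<times> real" where
  "node n k = (real_of_int (fst k) / real n, real_of_int (snd k) / real n)"

definition shift :: "nat \<Rightarrow> real \<times> real \<Rightarrow> int \<times> int \<Rightarrow> real \<times> real" where
  "shift n x k = (real n * fst x - real_of_int (fst k), real n * snd x - real_of_int (snd k))"

definition NN_op ::
  "(real \<Rightarrow> real) \<Rightarrow> nat \<Rightarrow> nat \<Rightarrow> nat \<Rightarrow> (real \<times> real \<Rightarrow> real) \<Rightarrow> real \<times> real \<Rightarrow> real" where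
  "NN_op \<sigma> N M n f x =
     (\<Sum>k\<in>grid N M n. f (node n k) * Psi \<sigma> (shift n x k)) /
     (\<Sum>k\<in>grid N M n. Psi \<sigma> (shift n x k))"

definition pixel_side :: "nat \<Rightarrow> nat \<Rightarrow> real set" where
  "pixel_side N i = (if i = N then {real i - 1..real i} else {real i - 1..<real i})"

definition pixel :: "nat \<Rightarrow> nat \<Rightarrow> nat \<Rightarrow> nat \<Rightarrow> (real \<times> real) set" where
  "pixel N M i j = pixel_side N i \<times> pixel_side M j"

text \<open>A function on the rectangle is represented by a total function whose values
  outside the rectangle are unconstrained.\<close>

definition digital_image :: "nat \<Rightarrow> nat \<Rightarrow> (real \<times> real \<Rightarrow> real) \<Rightarrow> bool" where
  "digital_image N M f \<longleftrightarrow>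
     (\<exists>F :: nat \<Rightarrow> nat \<Rightarrow> nat.
        (\<forall>i\<in>{1..N}. \<forall>j\<in>{1..M}. F i j \<in> {0..255}) \<and>
        (\<forall>x\<in>rect N M. f x = (\<Sum>i=1..N. \<Sum>j=1..M. real (F i j) * indicator (pixel N M i j) x)))"

text \<open>The Bochner integral is 0 for a function that is not integrable, so this is the
  \<open>L\<^sup>p\<close>-norm only for functions in \<open>L\<^sup>p\<close>; the lemma \<open>Lp_error_integrable\<close> below shows that the
  approximation error is one.\<close>

definition Lp_norm :: "real \<Rightarrow> (real \<times> real) set \<Rightarrow> (real \<times> real \<Rightarrow> real) \<Rightarrow> real" where
  "Lp_norm p S g = (LINT x:S|lebesgue. \<bar>g x\<bar> powr p) powr (1 / p)"

lemma phi_ramp_nonneg: "0 \<le> phi ramp x"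
  by (auto simp: phi_def ramp_def)

lemma Psi_ramp_nonneg: "0 \<le> Psi ramp x"
  by (simp add: Psi_def phi_ramp_nonneg)

lemma ramp_measurable [measurable]: "ramp \<in> borel_measurable borel"
  unfolding ramp_def [abs_def] by measurable

lemma NN_op_ramp_measurable: "NN_op ramp N M n f \<in> borel_measurable borel"
  unfolding NN_op_def [abs_def] Psi_def phi_def shift_def fst_conv snd_conv
  by (intro borel_measurable_divide borel_measurable_sum borel_measurable_times
        borel_measurable_const borel_measurable_diff
        measurable_compose [OF _ ramp_measurable] borel_measurable_add
        borel_measurable_continuous_onI continuous_intros)

lemma NN_op_ramp_bound:
  assumes "\<And>k. k \<in> grid N M n \<Longrightarrow> \<bar>f (node n k)\<bar> \<le> B" "0 \<le> B"
  shows "\<bar>NN_op ramp N M n f x\<bar> \<le> B"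
proof -
  let ?D = "\<Sum>k\<in>grid N M n. Psi ramp (shift n x k)"
  let ?U = "\<Sum>k\<in>grid N M n. f (node n k) * Psi ramp (shift n x k)"
  have "\<bar>?U\<bar> \<le> (\<Sum>k\<in>grid N M n. \<bar>f (node n k) * Psi ramp (shift n x k)\<bar>)"
    by (rule sum_abs)
  also have "\<dots> \<le> (\<Sum>k\<in>grid N M n. B * Psi ramp (shift n x k))"
    using assms by (intro sum_mono) (auto simp: abs_mult Psi_ramp_nonneg intro!: mult_right_mono)
  also have "\<dots> = B * ?D" by (simp add: sum_distrib_left)
  finally have "\<bar>?U\<bar> \<le> B * ?D" .
  moreover have "0 \<le> ?D" by (intro sum_nonneg Psi_ramp_nonneg)
  ultimately show ?thesis
    using assms(2) by (cases "?D = 0") (auto simp: NN_op_def divide_le_eq)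
qed

lemma Lp_error_integrable:
  assumes "digital_image N M f" "1 \<le> p"
  shows "set_integrable lebesgue (rect N M) (\<lambda>x. \<bar>NN_op ramp N M n f x - f x\<bar> powr p)"
proof -
  obtain F :: "nat \<Rightarrow> nat \<Rightarrow> nat" where
    f: "\<And>x. x \<in> rect N M \<Longrightarrow>
          f x = (\<Sum>i=1..N. \<Sum>j=1..M. real (F i j) * indicator (pixel N M i j) x)"
    using assms(1) unfolding digital_image_def by blast
  define g where "g x = (\<Sum>i=1..N. \<Sum>j=1..M. real (F i j) * indicator (pixel N M i j) x)"
    for x :: "real \<times> real"
  define K where "K = Max (insert 0 ((\<lambda>k. \<bar>f (node n k)\<bar>) ` grid N M n))"
  define L where "L = (\<Sum>i=1..N. \<Sum>j=1..M. real (F i j))"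
  have fin: "finite (grid N M n)" by (simp add: grid_def)
  have K: "\<bar>NN_op ramp N M n f x\<bar> \<le> K" for x
    by (rule NN_op_ramp_bound) (use fin in \<open>auto simp: K_def intro!: Max_ge\<close>)
  have "0 \<le> g x" "g x \<le> L" for x
    unfolding g_def L_def
    by (intro sum_nonneg sum_mono; simp add: indicator_def)+
  then have bound: "\<bar>NN_op ramp N M n f x - g x\<bar> \<le> K + L" for x
    using K [of x] by (smt (verit))
  have ps: "pixel_side N i \<in> sets borel" for N i by (simp add: pixel_side_def)
  have px: "pixel N M i j \<in> sets borel" for i j
    unfolding pixel_def by (intro borel_Times ps)
  have g: "g \<in> borel_measurable borel"
    unfolding g_def [abs_def]
    by (intro borel_measurable_sum borel_measurable_times borel_measurable_const
          borel_measurable_indicator px)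
  have R: "rect N M = cbox (0, 0) (real N, real M)"
    by (simp add: rect_def cbox_Pair_eq)
  have "set_integrable lborel (rect N M) (\<lambda>x. \<bar>NN_op ramp N M n f x - g x\<bar> powr p)"
    unfolding set_integrable_def
  proof (rule integrableI_bounded_set_indicator [where B = "(K + L) powr p"])
    show "(\<lambda>x. \<bar>NN_op ramp N M n f x - g x\<bar> powr p) \<in> borel_measurable lborel"
      using NN_op_ramp_measurable [of N M n f] g by simp
    show "AE x in lborel. x \<in> rect N M \<longrightarrow>
            norm (\<bar>NN_op ramp N M n f x - g x\<bar> powr p) \<le> (K + L) powr p"
      using bound assms(2) by (auto intro!: powr_mono2)
    show "emeasure lborel (rect N M) < \<infinity>"
      unfolding R by (rule emeasure_lborel_cbox_finite)
  qed (simp add: R)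
  then have "set_integrable lebesgue (rect N M) (\<lambda>x. \<bar>NN_op ramp N M n f x - g x\<bar> powr p)"
    unfolding set_integrable_def by (simp add: integrable_completion borel_measurable_integrable)
  then show ?thesis
    by (rule set_integrable_cong [THEN iffD1, rotated -1]) (auto simp: f g_def)
qed

end

theory Submission imports Defs begin

text \<open>
  For the ramp function the kernel \<^term>\<open>Psi ramp\<close> is compactly supported: it vanishes unless both
  coordinates are less than \<open>3/2\<close> in absolute value. So the operator is a local average: its value
  at \<open>x\<close> depends only on the samples at nodes whose coordinates differ from those of \<open>x\<close> by less
  than \<open>3/(2n)\<close>. If no coordinate of \<open>x\<close> is that close to an integer, these nodes all lie in the
  pixel of \<open>x\<close>, the averaged samples all equal \<open>f x\<close>, and the error at \<open>x\<close> is zero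
  (\<open>NN_op_ramp_exact\<close>). Elsewhere the error is at most \<open>255\<close>, since an average of numbers in
  \<open>[0, 255]\<close> is compared with such a number (\<open>NN_op_ramp_error_le\<close>).

  The exceptional points lie in a union of \<open>(N + 1) + (M + 1)\<close> strips of width \<open>3/n\<close> around the
  grid lines, of area at most \<open>12 M N / n\<close> (\<open>measure_strips_le\<close>). Hence the \<open>p\<close>-th power of the
  norm is at most \<open>255\<^sup>p \<cdot> 12 M N / n\<close>. The
  resulting bound \<open>255 (12 M N / n)\<^sup>1\<^sup>/\<^sup>p\<close> (\<open>Lp_error_le\<close>) is stronger than the claimed one, because
  \<open>2 powr (p - 1) \<ge> 1\<close>, and \<open>ln n \<ge> 1\<close> as soon as \<open>n \<ge> 3\<close>.
\<close>

section \<open>The averaging kernel\<close>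

lemma phi_ramp_pos: "\<bar>t\<bar> < 3/2 \<Longrightarrow> 0 < phi ramp t"
  by (auto simp: phi_def ramp_def)

lemma phi_ramp_eq_0: "3/2 \<le> \<bar>t\<bar> \<Longrightarrow> phi ramp t = 0"
  by (auto simp: phi_def ramp_def)

lemma finite_grid: "finite (grid N M n)"
  by (simp add: grid_def)

lemma node_in_rect:
  assumes "0 < n" "k \<in> grid N M n"
  shows "node n k \<in> rect N M"
proof -
  obtain a b where k: "k = (a, b)" "0 \<le> a" "a \<le> int n * int N" "0 \<le> b" "b \<le> int n * int M"
    using assms(2) by (auto simp: grid_def)
  have "real_of_int a \<le> real n * real N" "real_of_int b \<le> real n * real M"
    using k(3,5) by (metis of_int_le_iff of_int_mult of_int_of_nat_eq)+
  then show ?thesis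
    using assms(1) k by (simp add: node_def rect_def divide_le_eq mult.commute)
qed

text \<open>The division in the operator is proper on the rectangle: the node below and to the left of
  \<open>n x\<close> belongs to the grid and has positive weight.\<close>

lemma sum_Psi_ramp_pos:
  assumes "x \<in> rect N M"
  shows "0 < (\<Sum>k\<in>grid N M n. Psi ramp (shift n x k))"
proof -
  define k where "k = (\<lfloor>real n * fst x\<rfloor>, \<lfloor>real n * snd x\<rfloor>)"
  have x: "0 \<le> fst x" "fst x \<le> real N" "0 \<le> snd x" "snd x \<le> real M"
    using assms by (auto simp: rect_def)
  have floor_le: "\<lfloor>real n * t\<rfloor> \<le> int n * int L" if "t \<le> real L" for t L
  proof -
    have "real n * t \<le> real_of_int (int n * int L)"
      using that by (simp add: mult_left_mono)
    then show ?thesis by (metis floor_mono floor_of_int)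
  qed
  have k: "k \<in> grid N M n"
    using x floor_le by (simp add: k_def grid_def)
  have "0 < Psi ramp (shift n x k)"
    unfolding Psi_def shift_def k_def fst_conv snd_conv
    by (intro mult_pos_pos phi_ramp_pos) linarith+
  then show ?thesis
    using finite_grid k Psi_ramp_nonneg by (intro sum_pos2)
qed

lemma NN_op_ramp_nonneg:
  assumes "\<And>k. k \<in> grid N M n \<Longrightarrow> 0 \<le> f (node n k)"
  shows "0 \<le> NN_op ramp N M n f x"
  unfolding NN_op_def
  by (intro divide_nonneg_nonneg sum_nonneg mult_nonneg_nonneg assms Psi_ramp_nonneg)

lemma NN_op_ramp_eqI:
  assumes "0 < n" "x \<in> rect N M"
    and near: "\<And>k. \<lbrakk>k \<in> grid N M n;
        \<bar>fst x - fst (node n k)\<bar> < 3 / (2 * real n); \<bar>snd x - snd (node n k)\<bar> < 3 / (2 * real n)\<rbrakk>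
        \<Longrightarrow> f (node n k) = c"
  shows "NN_op ramp N M n f x = c"
proof -
  have "f (node n k) * Psi ramp (shift n x k) = c * Psi ramp (shift n x k)"
    if k: "k \<in> grid N M n" for k
  proof (cases "Psi ramp (shift n x k) = 0")
    case False
    then have "\<bar>real n * fst x - real_of_int (fst k)\<bar> < 3/2"
      "\<bar>real n * snd x - real_of_int (snd k)\<bar> < 3/2"
      using phi_ramp_eq_0 by (auto simp: Psi_def shift_def not_le [symmetric])
    then have "\<bar>fst x - fst (node n k)\<bar> < 3 / (2 * real n)"
      "\<bar>snd x - snd (node n k)\<bar> < 3 / (2 * real n)"
      using assms(1) by (simp_all add: node_def abs_less_iff field_simps)
    then show ?thesis
      using near k by simp
  qed simp
  then have "(\<Sum>k\<in>grid N M n. f (node n k) * Psi ramp (shift n x k))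
      = c * (\<Sum>k\<in>grid N M n. Psi ramp (shift n x k))"
    unfolding sum_distrib_left by (rule sum.cong [OF refl])
  then show ?thesis
    using sum_Psi_ramp_pos [OF assms(2), of n] by (simp add: NN_op_def)
qed

section \<open>Pixels and digital images\<close>

lemma pixel_side_cover:
  assumes "0 < N" "0 \<le> t" "t \<le> real N"
  obtains i where "i \<in> {1..N}" "t \<in> pixel_side N i"
proof (cases "t = real N")
  case True
  then show ?thesis
    using assms by (intro that [of N]) (auto simp: pixel_side_def)
next
  case False
  have "nat \<lfloor>t\<rfloor> < N"
    using False assms by linarith
  moreover have "t \<in> pixel_side N (Suc (nat \<lfloor>t\<rfloor>))"
    using assms(2) by (auto simp: pixel_side_def) linarith+
  ultimately show ?thesis
    by (intro that [of "Suc (nat \<lfloor>t\<rfloor>)"]) auto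
qed

lemma pixel_side_unique:
  assumes "t \<in> pixel_side N i" "t \<in> pixel_side N j" "i \<in> {1..N}" "j \<in> {1..N}"
  shows "i = j"
proof (rule ccontr)
  assume "i \<noteq> j"
  then consider "real i \<le> real j - 1" "i \<noteq> N" | "real j \<le> real i - 1" "j \<noteq> N"
    using assms(3,4) by (cases "i < j") auto
  then show False
    using assms(1,2) by cases (auto simp: pixel_side_def split: if_splits)
qed

lemma digital_image_values:
  assumes "digital_image N M f"
  obtains F :: "nat \<Rightarrow> nat \<Rightarrow> nat"
  where "\<And>i j. \<lbrakk>i \<in> {1..N}; j \<in> {1..M}\<rbrakk> \<Longrightarrow> F i j \<le> 255"
    and "\<And>i j x. \<lbrakk>i \<in> {1..N}; j \<in> {1..M}; x \<in> rect N M; x \<in> pixel N M i j\<rbrakk>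
      \<Longrightarrow> f x = real (F i j)"
proof -
  obtain F :: "nat \<Rightarrow> nat \<Rightarrow> nat" where
    range: "\<forall>i\<in>{1..N}. \<forall>j\<in>{1..M}. F i j \<in> {0..255}"
    and f: "\<And>x. x \<in> rect N M \<Longrightarrow>
      f x = (\<Sum>i=1..N. \<Sum>j=1..M. real (F i j) * indicator (pixel N M i j) x)"
    using assms unfolding digital_image_def by blast
  have "f x = real (F i j)"
    if ij: "i \<in> {1..N}" "j \<in> {1..M}" "x \<in> rect N M" "x \<in> pixel N M i j" for i j x
  proof -
    have "(indicator (pixel N M i' j') x :: real) = (if i = i' then if j = j' then 1 else 0 else 0)"
      if "i' \<in> {1..N}" "j' \<in> {1..M}" for i' j'
      using that ij pixel_side_unique [of "fst x" N i i'] pixel_side_unique [of "snd x" M j j']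
      by (auto simp: pixel_def indicator_def)
    then have "f x = (\<Sum>i'=1..N. \<Sum>j'=1..M. if i = i' then if j = j' then real (F i' j') else 0 else 0)"
      unfolding f [OF ij(3)] by (intro sum.cong refl) auto
    also have "\<dots> = (\<Sum>i'=1..N. if i = i' then \<Sum>j'=1..M. if j = j' then real (F i' j') else 0 else 0)"
      by (intro sum.cong) auto
    also have "\<dots> = real (F i j)"
      using ij by (simp add: sum.delta)
    finally show ?thesis .
  qed
  moreover have "F i j \<le> 255" if "i \<in> {1..N}" "j \<in> {1..M}" for i j
    using range that by simp
  ultimately show thesis
    by (rule that [rotated])
qed

lemma pixel_cover:
  assumes "0 < N" "0 < M" "x \<in> rect N M"
  obtains i j where "i \<in> {1..N}" "j \<in> {1..M}" "x \<in> pixel N M i j"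
proof -
  have "0 \<le> fst x" "fst x \<le> real N" "0 \<le> snd x" "snd x \<le> real M"
    using assms(3) by (auto simp: rect_def)
  then show thesis
    using that assms(1,2) by (metis pixel_side_cover pixel_def mem_Times_iff)
qed

lemma digital_image_range:
  assumes "digital_image N M f" "0 < N" "0 < M" "x \<in> rect N M"
  shows "0 \<le> f x \<and> f x \<le> 255"
proof -
  obtain F where F: "\<And>i j. \<lbrakk>i \<in> {1..N}; j \<in> {1..M}\<rbrakk> \<Longrightarrow> F i j \<le> 255"
    "\<And>i j x. \<lbrakk>i \<in> {1..N}; j \<in> {1..M}; x \<in> rect N M; x \<in> pixel N M i j\<rbrakk> \<Longrightarrow> f x = real (F i j)"
    using digital_image_values [OF assms(1)] by metis
  obtain i j where "i \<in> {1..N}" "j \<in> {1..M}" "x \<in> pixel N M i j"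
    using pixel_cover assms by metis
  with F assms(4) show ?thesis
    by (metis of_nat_0_le_iff of_nat_le_iff of_nat_numeral)
qed

section \<open>The pointwise error\<close>

text \<open>Both terms of the difference lie in \<open>[0, 255]\<close>, so its bound is \<open>255\<close> rather than the \<open>510\<close>
  of the triangle inequality.\<close>

lemma NN_op_ramp_error_le:
  assumes "digital_image N M f" "0 < N" "0 < M" "0 < n" "x \<in> rect N M"
  shows "\<bar>NN_op ramp N M n f x - f x\<bar> \<le> 255"
proof -
  have range: "0 \<le> f (node n k) \<and> f (node n k) \<le> 255" if "k \<in> grid N M n" for k
    using digital_image_range assms(1-3) node_in_rect [OF assms(4) that] by blast
  have "0 \<le> NN_op ramp N M n f x"
    using range by (intro NN_op_ramp_nonneg) blast
  moreover have "\<bar>NN_op ramp N M n f x\<bar> \<le> 255"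
    using range by (intro NN_op_ramp_bound) auto
  ultimately show ?thesis
    using digital_image_range [OF assms(1-3,5)] by linarith
qed

text \<open>The values \<open>m = 0\<close> and \<open>m = N\<close> are included, although no jump occurs there, so that every
  pixel side can be treated alike, with both of its endpoints excluded.\<close>

definition near_grid_line :: "real \<Rightarrow> nat \<Rightarrow> real set" where
  "near_grid_line \<delta> N = (\<Union>m\<le>N. {real m - \<delta>..real m + \<delta>})"

lemma pixel_side_stable:
  assumes "i \<in> {1..N}" "t \<in> pixel_side N i" "t \<notin> near_grid_line \<delta> N" "\<bar>t - s\<bar> < \<delta>"
  shows "s \<in> pixel_side N i"
proof -
  have far: "\<not> (real m - \<delta> \<le> t \<and> t \<le> real m + \<delta>)" if "m \<le> N" for m
    using assms(3) that by (auto simp: near_grid_line_def)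
  have "i \<le> N" "i - 1 \<le> N" "real (i - 1) = real i - 1"
    using assms(1) by auto
  then have "\<not> (real i - \<delta> \<le> t \<and> t \<le> real i + \<delta>)" "\<not> (real i - 1 - \<delta> \<le> t \<and> t \<le> real i - 1 + \<delta>)"
    using far by metis+
  moreover have "real i - 1 \<le> t" "t \<le> real i"
    using assms(2) by (auto simp: pixel_side_def split: if_splits)
  ultimately have "real i - 1 < s" "s < real i"
    using assms(4) by linarith+
  then show ?thesis
    by (simp add: pixel_side_def)
qed

lemma NN_op_ramp_exact:
  assumes "digital_image N M f" "0 < N" "0 < M" "0 < n" "x \<in> rect N M"
    and far: "fst x \<notin> near_grid_line (3 / (2 * real n)) N"
      "snd x \<notin> near_grid_line (3 / (2 * real n)) M"
  shows "NN_op ramp N M n f x = f x"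
proof -
  obtain F where F: "\<And>i j x. \<lbrakk>i \<in> {1..N}; j \<in> {1..M}; x \<in> rect N M; x \<in> pixel N M i j\<rbrakk>
      \<Longrightarrow> f x = real (F i j)"
    using digital_image_values [OF assms(1)] by metis
  obtain i j where ij: "i \<in> {1..N}" "j \<in> {1..M}" "x \<in> pixel N M i j"
    using pixel_cover assms(2,3,5) by metis
  then have side: "fst x \<in> pixel_side N i" "snd x \<in> pixel_side M j"
    by (auto simp: pixel_def)
  show ?thesis
  proof (rule NN_op_ramp_eqI)
    fix k
    assume k: "k \<in> grid N M n"
      and near: "\<bar>fst x - fst (node n k)\<bar> < 3 / (2 * real n)"
        "\<bar>snd x - snd (node n k)\<bar> < 3 / (2 * real n)"
    have "node n k \<in> pixel N M i j"
      using pixel_side_stable [OF ij(1) side(1) far(1) near(1)]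
        pixel_side_stable [OF ij(2) side(2) far(2) near(2)]
      by (simp add: pixel_def mem_Times_iff)
    then show "f (node n k) = f x"
      using F [OF ij(1,2)] ij(3) assms(5) node_in_rect [OF assms(4) k] by metis
  qed (use assms in auto)
qed

section \<open>The norm of the error\<close>

definition strips :: "real \<Rightarrow> nat \<Rightarrow> nat \<Rightarrow> (real \<times> real) set" where
  "strips \<delta> N M = near_grid_line \<delta> N \<times> {0..real M} \<union> {0..real N} \<times> near_grid_line \<delta> M"

lemma strips_eq_boxes:
  "strips \<delta> N M = (\<Union>m\<le>N. cbox (real m - \<delta>, 0) (real m + \<delta>, real M))
    \<union> (\<Union>m\<le>M. cbox (0, real m - \<delta>) (real N, real m + \<delta>))"
  by (auto simp: strips_def near_grid_line_def cbox_Pair_eq)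

lemma strips_lmeasurable: "strips \<delta> N M \<in> lmeasurable"
  unfolding strips_eq_boxes by (intro fmeasurable.Un fmeasurable.finite_UN) auto

lemma measure_strips_le:
  assumes "0 \<le> \<delta>" "0 < N" "0 < M"
  shows "measure lebesgue (strips \<delta> N M) \<le> 8 * \<delta> * real M * real N"
proof -
  have box: "measure lborel (cbox (a, c) (b, d)) = (b - a) * (d - c)"
    if "a \<le> b" "c \<le> d" for a b c d :: real
    using that by (simp add: content_Pair)
  have "measure lebesgue (strips \<delta> N M)
    \<le> measure lebesgue (\<Union>m\<le>N. cbox (real m - \<delta>, 0) (real m + \<delta>, real M))
      + measure lebesgue (\<Union>m\<le>M. cbox (0, real m - \<delta>) (real N, real m + \<delta>))"
    unfolding strips_eq_boxes by (intro measure_Un_le) auto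
  also have "\<dots> \<le> (\<Sum>m\<le>N. measure lebesgue (cbox (real m - \<delta>, 0) (real m + \<delta>, real M)))
      + (\<Sum>m\<le>M. measure lebesgue (cbox (0, real m - \<delta>) (real N, real m + \<delta>)))"
    by (intro add_mono measure_UNION_le) auto
  also have "\<dots> = (real N + 1) * (2 * \<delta> * real M) + (real M + 1) * (2 * \<delta> * real N)"
    using assms(1) by (simp add: box algebra_simps)
  also have "\<dots> \<le> (2 * real N) * (2 * \<delta> * real M) + (2 * real M) * (2 * \<delta> * real N)"
    using assms by (intro add_mono mult_right_mono) auto
  finally show ?thesis
    by (simp add: algebra_simps)
qed

lemma Lp_error_le:
  assumes "1 \<le> p" "0 < N" "0 < M" "digital_image N M f" "0 < n"
  shows "Lp_norm p (rect N M) (\<lambda>x. NN_op ramp N M n f x - f x)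
    \<le> 255 * (12 * real M * real N / real n) powr (1 / p)"
proof -
  define S where "S = strips (3 / (2 * real n)) N M"
  have S: "S \<in> lmeasurable"
    unfolding S_def by (rule strips_lmeasurable)
  have "(LINT x:rect N M|lebesgue. \<bar>NN_op ramp N M n f x - f x\<bar> powr p)
      \<le> (LINT x|lebesgue. 255 powr p * indicator S x)"
    unfolding set_lebesgue_integral_def
  proof (rule integral_mono)
    show "integrable lebesgue
        (\<lambda>x. indicator (rect N M) x *\<^sub>R \<bar>NN_op ramp N M n f x - f x\<bar> powr p)"
      using Lp_error_integrable [OF assms(4,1)] unfolding set_integrable_def .
    show "integrable lebesgue (\<lambda>x. 255 powr p * indicator S x :: real)"
      using S by (simp add: lmeasurable_iff_integrable)
    fix x :: "real \<times> real"
    show "indicator (rect N M) x *\<^sub>R \<bar>NN_op ramp N M n f x - f x\<bar> powr p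
        \<le> 255 powr p * indicator S x"
    proof (cases "x \<in> rect N M")
      case True
      have "\<bar>NN_op ramp N M n f x - f x\<bar> powr p \<le> 255 powr p"
        using NN_op_ramp_error_le [OF assms(4,2,3,5) True] assms(1) by (intro powr_mono2) auto
      moreover have "NN_op ramp N M n f x = f x" if "x \<notin> S"
      proof (rule NN_op_ramp_exact [OF assms(4,2,3,5) True])
        show "fst x \<notin> near_grid_line (3 / (2 * real n)) N"
          "snd x \<notin> near_grid_line (3 / (2 * real n)) M"
          using that True by (auto simp: S_def strips_def rect_def)
      qed
      ultimately show ?thesis
        using True by (cases "x \<in> S") simp_all
    qed (simp add: indicator_def)
  qed
  also have "\<dots> = 255 powr p * measure lebesgue S"
    by simp
  also have "\<dots> \<le> 255 powr p * (12 * real M * real N / real n)"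
    using measure_strips_le [of "3 / (2 * real n)" N M] assms
    by (intro mult_left_mono) (simp_all add: S_def field_simps)
  finally have "Lp_norm p (rect N M) (\<lambda>x. NN_op ramp N M n f x - f x)
      \<le> (255 powr p * (12 * real M * real N / real n)) powr (1 / p)"
    unfolding Lp_norm_def set_lebesgue_integral_def
    using assms(1) by (intro powr_mono2 Bochner_Integration.integral_nonneg) auto
  also have "\<dots> = 255 * (12 * real M * real N / real n) powr (1 / p)"
    using assms(1) by (subst powr_mult) (simp_all add: powr_powr)
  finally show ?thesis .
qed

theorem corollary13:
  fixes p :: real and N M :: nat and f :: "real \<times> real \<Rightarrow> real"
  assumes "1 \<le> p" and "0 < N" and "0 < M" and "digital_image N M f"
  shows "\<exists>C>0. \<forall>\<^sub>F n in sequentially.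
    Lp_norm p (rect N M) (\<lambda>x. NN_op ramp N M n f x - f x)
      \<le> 255 * (2 powr (p - 1) * real M * real N) powr (1 / p) * C * (ln (real n) / real n) powr (1 / p)"
proof (intro exI conjI)
  show "(0::real) < 12 powr (1 / p)"
    by simp
  show "\<forall>\<^sub>F n in sequentially. Lp_norm p (rect N M) (\<lambda>x. NN_op ramp N M n f x - f x)
      \<le> 255 * (2 powr (p - 1) * real M * real N) powr (1 / p) * 12 powr (1 / p)
        * (ln (real n) / real n) powr (1 / p)"
    using eventually_ge_at_top [of 3]
  proof eventually_elim
    case (elim n)
    have "exp 1 \<le> real n"
      using exp_le elim by linarith
    then have ln: "1 \<le> ln (real n)"
      using elim by (simp add: ln_ge_iff)
    have two: "1 \<le> (2::real) powr (p - 1)"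
      using assms(1) by (simp add: ge_one_powr_ge_zero)
    have "1 \<le> 2 powr (p - 1) * ln (real n)"
      using mult_mono [OF two ln] by simp
    then have "12 * real M * real N / real n * 1
        \<le> 12 * real M * real N / real n * (2 powr (p - 1) * ln (real n))"
      by (intro mult_left_mono) auto
    also have "\<dots> = (2 powr (p - 1) * real M * real N) * 12 * (ln (real n) / real n)"
      by simp
    finally have "(12 * real M * real N / real n) powr (1 / p)
        \<le> ((2 powr (p - 1) * real M * real N) * 12 * (ln (real n) / real n)) powr (1 / p)"
      using assms(1) by (intro powr_mono2) auto
    also have "\<dots> = (2 powr (p - 1) * real M * real N) powr (1 / p) * 12 powr (1 / p)
        * (ln (real n) / real n) powr (1 / p)"
      using ln by (subst powr_mult; simp)+
    finally show ?case
      using Lp_error_le [OF assms, of n] elim by simp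
  qed
qed

end
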